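(* There is a universal constant $C(2)>0$ (independent of $u$, $R$ and $\Theta$) such that the following holds. Let $R>0$, let $\Theta\in\mathbb{R}$ be a constant, and let $u$ be a smooth solution on $B_{3R}(0)\subset\mathbb{R}^2$ of the special Lagrangian equation $$\arctan\lambda_1+\arctan\lambda_2=\Theta,$$ where $\lambda_1,\lambda_2$ are the eigenvalues of the Hessian $D^2u$. Then $$\max_{B_R(0)}|Du|\le C(2)\left[\operatorname*{osc}_{B_{3R}(0)}\frac{u}{R}+1\right].$$
   Context: $B_r(x)$ denotes the open Euclidean ball (disc) of radius $r$ centred at $x$ in $\mathbb{R}^2$. $Du$ and $D^2u$ are the Euclidean gradient and Hessian. $\arctan$ takes values in $(-\pi/2,\pi/2)$, so the phase $\Theta$ necessarily lies in $(-\pi,\pi)$. $\operatorname{osc}_{B}f=\sup_B f-\inf_B f$ (possibly $+\infty$, in which case the estimate is vacuous), so $\operatorname{osc}_{B_{3R}(0)}\frac{u}{R}=\frac1R\operatorname{osc}_{B_{3R}(0)}u$; $\max_{B_R(0)}$ is understood as a supremum. *)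

theory Defs
  imports "HOL-Analysis.Analysis" "HOL-Computational_Algebra.Polynomial"
begin

definition partial_derivative :: "'n::finite \<Rightarrow> (real^'n \<Rightarrow> real) \<Rightarrow> real^'n \<Rightarrow> real" where
  "partial_derivative i f x = frechet_derivative f (at x) (axis i 1)"

definition grad :: "(real^'n::finite \<Rightarrow> real) \<Rightarrow> real^'n \<Rightarrow> real^'n" where
  "grad f x = (\<chi> i. partial_derivative i f x)"

definition hessian :: "(real^'n::finite \<Rightarrow> real) \<Rightarrow> real^'n \<Rightarrow> real^'n^'n" where
  "hessian f x = (\<chi> i j. partial_derivative i (partial_derivative j f) x)"

(* Intended for open S only: the derivatives are those of f on a full neighbourhood of each
   point of S, and the values of f outside S are then irrelevant. *)
primrec C_k_on :: "nat \<Rightarrow> (real^'n::finite \<Rightarrow> real) \<Rightarrow> (real^'n) set \<Rightarrow> bool" where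
  "C_k_on 0 f S \<longleftrightarrow> continuous_on S f"
| "C_k_on (Suc k) f S \<longleftrightarrow>
     (\<forall>x\<in>S. f differentiable at x) \<and> (\<forall>i. C_k_on k (partial_derivative i f) S)"

definition smooth_on :: "(real^'n::finite \<Rightarrow> real) \<Rightarrow> (real^'n) set \<Rightarrow> bool" where
  "smooth_on f S \<longleftrightarrow> (\<forall>k. C_k_on k f S)"

definition charpoly :: "real^'n^'n \<Rightarrow> real poly" where
  "charpoly A = det (mat [:0, 1:] - (\<chi> i j. [:A $ i $ j:]))"

(* Real eigenvalues with algebraic multiplicity; for a symmetric matrix these are all of its
   eigenvalues. *)
definition eigenvalues :: "real^'n^'n \<Rightarrow> real multiset" where
  "eigenvalues A = proots (charpoly A)"

lemma charpoly_2: "charpoly (A :: real^2^2) = [:det A, - trace A, 1:]"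
  by (simp add: charpoly_def det_2 trace_def sum_2 mat_def algebra_simps)

lemma in_eigenvalues_2_iff:
  "t \<in># eigenvalues (A :: real^2^2) \<longleftrightarrow> (\<exists>v. v \<noteq> 0 \<and> A *v v = t *\<^sub>R v)"
proof -
  have "t \<in># eigenvalues A \<longleftrightarrow> det (A - t *\<^sub>R mat 1) = 0"
    by (simp add: eigenvalues_def charpoly_2 det_2 trace_def sum_2 mat_def algebra_simps)
  also have "\<dots> \<longleftrightarrow> (\<exists>v. v \<noteq> 0 \<and> (A - t *\<^sub>R mat 1) *v v = 0)"
    by (metis invertible_det_nz invertible_left_inverse matrix_left_invertible_ker)
  also have "\<dots> \<longleftrightarrow> (\<exists>v. v \<noteq> 0 \<and> A *v v = t *\<^sub>R v)"
    by (simp add: matrix_vector_mult_diff_rdistrib scaleR_matrix_vector_assoc [symmetric])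
  finally show ?thesis .
qed

definition special_lagrangian_on :: "real \<Rightarrow> (real^2 \<Rightarrow> real) \<Rightarrow> (real^2) set \<Rightarrow> bool" where
  "special_lagrangian_on \<Theta> u S \<longleftrightarrow>
     (\<forall>x\<in>S. \<exists>l1 l2. eigenvalues (hessian u x) = {#l1, l2#} \<and> arctan l1 + arctan l2 = \<Theta>)"

(* Extended-real valued: equals infinity when f is unbounded above or below on a nonempty S. *)
definition osc :: "('a \<Rightarrow> real) \<Rightarrow> 'a set \<Rightarrow> ereal" where
  "osc f S = (SUP x\<in>S. ereal (f x)) - (INF x\<in>S. ereal (f x))"

end

theory Submission
  imports Defs "HOL-Complex_Analysis.Complex_Analysis"
begin

text \<open>
Replacing \<open>u\<close> by \<open>- u\<close> if necessary, let \<open>S = sin \<Theta> \<ge> 0\<close> and \<open>C = cos \<Theta>\<close>. The estimate is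
proved at the centre of a disc of radius \<open>2 R\<close>, and by scaling \<open>R = 1\<close>. Let \<open>M > 0\<close> bound the
oscillation of \<open>u\<close>, and let \<open>q\<close> be its gradient; the claim is that \<open>\<bar>q 0\<bar>\<close> is at most a
universal multiple of \<open>M\<close>. This is homogeneous in \<open>M\<close>, so that it yields the additive constant
\<open>1\<close> for every radius.

The equation says that \<open>S D\<^sup>2u + C I\<close> is positive definite with determinant \<open>1\<close> if \<open>S > 0\<close>, and
that \<open>u\<close> is harmonic if \<open>S = 0\<close>. In both cases \<open>S u + C \<bar>x\<bar>\<^sup>2 / 2\<close> is convex, and comparison
along a segment of length \<open>r \<le> 1\<close> gives \<open>S r \<bar>q\<bar> \<le> S M + C r\<^sup>2 / 2\<close> on the unit disc. Choosing
\<open>r\<close> well, either the claim follows at once, or \<open>C > 0\<close> and \<open>S \<bar>q\<bar>\<^sup>2 \<le> 9 M / 4\<close> on the unit disc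
(\<open>gradient_dichotomy\<close>).

In the second case let \<open>s\<close> and \<open>c\<close> be the sine and cosine of \<open>\<Theta> / 2\<close>, so that \<open>s \<le> S\<close>. The Lewy
rotation \<open>\<Phi> x = c x + s q x\<close> satisfies \<open>\<bar>y - x\<bar> \<le> 2 \<bar>\<Phi> y - \<Phi> x\<bar>\<close>, so its image of
the unit disc contains a disc of radius \<open>1 / 2\<close>. The rotated gradient \<open>c q - s x\<close>, as a function
of \<open>\<Phi> x\<close>, is the conjugate of a holomorphic function (\<open>cauchy_riemann\<close>). It is thus the gradient
of a harmonic function, namely of
\<open>W = u + c s (\<bar>q\<bar>\<^sup>2 - \<bar>x\<bar>\<^sup>2) / 2 - s\<^sup>2 (x \<bullet> q)\<close>. The bound on \<open>S \<bar>q\<bar>\<^sup>2\<close>, together with \<open>s \<le> 4 M\<close>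
(the maximum principle, \<open>s_le_osc\<close>), shows that \<open>W\<close> oscillates by at most a multiple of \<open>M\<close>
(\<open>W_bounds\<close>). The interior gradient estimate for harmonic functions then bounds the rotated
gradient at \<open>\<Phi> 0\<close>, which is \<open>c q 0\<close> with \<open>c \<ge> 1 / 2\<close>.
\<close>

section \<open>Symmetry of second derivatives\<close>

text \<open>Young's form of the symmetry of second derivatives, which needs \<open>f\<close> to be differentiable near
\<open>x\<close> and its gradient \<open>g\<close> to be differentiable at \<open>x\<close> only. The second difference
\<open>f (x + \<tau> v + \<tau> w) - f (x + \<tau> v) - f (x + \<tau> w) + f x\<close> is symmetric in \<open>v\<close> and \<open>w\<close>,
and it equals \<open>\<tau>\<^sup>2 (L w \<bullet> v)\<close> up to an error of smaller order than \<open>\<tau>\<^sup>2\<close>.\<close>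
lemma gradient_derivative_symmetric:
  fixes f :: "'a::real_inner \<Rightarrow> real" and g L :: "'a \<Rightarrow> 'a"
  assumes S: "open S" "x \<in> S"
    and f: "\<And>y. y \<in> S \<Longrightarrow> (f has_derivative (\<lambda>e. g y \<bullet> e)) (at y)"
    and g: "(g has_derivative L) (at x)"
  shows "L v \<bullet> w = L w \<bullet> v"
proof -
  have lin: "bounded_linear L" using g by (rule has_derivative_bounded_linear)
  define K where "K = norm v + norm w"
  have K: "norm v \<le> K" "norm w \<le> K" "K \<ge> 0" by (auto simp: K_def)
  obtain r where r: "r > 0" "ball x r \<subseteq> S" using S open_contains_ball by blast
  have main: "\<bar>L v \<bullet> w - L w \<bullet> v\<bar> \<le> 6 * \<epsilon> * K\<^sup>2" if "\<epsilon> > 0" for \<epsilon>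
  proof -
    from g that obtain d where d: "d > 0"
      "\<And>y. norm (y - x) < d \<Longrightarrow> norm (g y - g x - L (y - x)) \<le> \<epsilon> * norm (y - x)"
      unfolding has_derivative_at_alt by blast
    \<comment> \<open>small enough for all points below to lie in the ball of radius \<open>r\<close> and within \<open>d\<close> of \<open>x\<close>\<close>
    define t where "t = min d r / (2 * K + 1) / 2"
    have t: "t > 0" "2 * t * K < d" "2 * t * K < r"
    proof -
      show t0: "t > 0" using d r K by (auto simp: t_def)
      have "2 * K + 1 \<noteq> 0" using K by linarith
      then have "2 * t * (2 * K + 1) = min d r" unfolding t_def by (simp only: times_divide_eq_left times_divide_eq_right) simp
      moreover have "2 * t * K < 2 * t * (2 * K + 1)" using t0 K by (intro mult_strict_left_mono) auto
      ultimately show "2 * t * K < d" "2 * t * K < r" by auto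
    qed
    have key: "\<bar>(f (x + t *\<^sub>R v + t *\<^sub>R w) - f (x + t *\<^sub>R v) - f (x + t *\<^sub>R w) + f x) - t\<^sup>2 * (L w \<bullet> v)\<bar>
        \<le> 3 * \<epsilon> * t\<^sup>2 * K\<^sup>2" if vw: "norm v \<le> K" "norm w \<le> K" for v w
    proof -
      have nb: "norm (a *\<^sub>R v + b *\<^sub>R w) \<le> (a + b) * K" if "0 \<le> a" "0 \<le> b" for a b
      proof -
        have "norm (a *\<^sub>R v + b *\<^sub>R w) \<le> a * norm v + b * norm w"
          using norm_triangle_ineq[of "a *\<^sub>R v" "b *\<^sub>R w"] that by simp
        also have "\<dots> \<le> a * K + b * K" using vw that by (intro add_mono mult_left_mono) auto
        finally show ?thesis by (simp add: algebra_simps)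
      qed
      have mem: "x + a *\<^sub>R v + b *\<^sub>R w \<in> S" "norm (a *\<^sub>R v + b *\<^sub>R w) < d"
        if "0 \<le> a" "a \<le> t" "0 \<le> b" "b \<le> t" for a b
      proof -
        have "(a + b) * K \<le> 2 * t * K" using that K by (intro mult_right_mono) auto
        then have *: "norm (a *\<^sub>R v + b *\<^sub>R w) \<le> 2 * t * K" using nb[of a b] that by linarith
        then show "norm (a *\<^sub>R v + b *\<^sub>R w) < d" using t by linarith
        have "dist x (x + a *\<^sub>R v + b *\<^sub>R w) < r" using * t by (simp add: dist_norm add.assoc norm_minus_commute) (simp add: add.commute)
        then show "x + a *\<^sub>R v + b *\<^sub>R w \<in> S" using r by auto
      qed
      define h where "h \<sigma> = f (x + \<sigma> *\<^sub>R v + t *\<^sub>R w) - f (x + \<sigma> *\<^sub>R v)" for \<sigma>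
      define h' where "h' \<sigma> = (g (x + \<sigma> *\<^sub>R v + t *\<^sub>R w) - g (x + \<sigma> *\<^sub>R v)) \<bullet> v" for \<sigma>
      have dh: "(h has_real_derivative h' \<sigma>) (at \<sigma>)" if "0 \<le> \<sigma>" "\<sigma> \<le> t" for \<sigma>
      proof -
        have 1: "((\<lambda>\<sigma>. f (x + \<sigma> *\<^sub>R v + t *\<^sub>R w)) has_derivative
             (\<lambda>e. g (x + \<sigma> *\<^sub>R v + t *\<^sub>R w) \<bullet> (e *\<^sub>R v))) (at \<sigma>)"
          by (rule has_derivative_compose[OF _ f])
            (auto intro!: derivative_eq_intros mem that t less_imp_le)
        have 2: "((\<lambda>\<sigma>. f (x + \<sigma> *\<^sub>R v)) has_derivative
             (\<lambda>e. g (x + \<sigma> *\<^sub>R v) \<bullet> (e *\<^sub>R v))) (at \<sigma>)"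
          by (rule has_derivative_compose[OF _ f])
            (use mem[of \<sigma> 0] that t in \<open>auto intro!: derivative_eq_intros\<close>)
        show ?thesis
          unfolding has_field_derivative_def h_def h'_def
          by (rule has_derivative_eq_rhs[OF has_derivative_diff[OF 1 2]])
            (auto simp: fun_eq_iff inner_diff_left algebra_simps)
      qed
      \<comment> \<open>the second difference is the increment of \<open>h\<close> over \<open>[0, t]\<close>\<close>
      obtain \<sigma> where \<sigma>: "0 < \<sigma>" "\<sigma> < t" "h t - h 0 = (t - 0) * h' \<sigma>"
        using MVT2[of 0 t h h'] t dh by auto
      define A where "A = g (x + \<sigma> *\<^sub>R v + t *\<^sub>R w) - g x - L (\<sigma> *\<^sub>R v + t *\<^sub>R w)"
      define B where "B = g (x + \<sigma> *\<^sub>R v) - g x - L (\<sigma> *\<^sub>R v)"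
      have "norm A \<le> \<epsilon> * norm (\<sigma> *\<^sub>R v + t *\<^sub>R w)"
        using d(2)[of "x + \<sigma> *\<^sub>R v + t *\<^sub>R w"] mem(2)[of \<sigma> t] \<sigma> t by (simp add: A_def add.assoc)
      also have "\<dots> \<le> \<epsilon> * (2 * t * K)"
      proof (rule mult_left_mono)
        have "(\<sigma> + t) * K \<le> 2 * t * K" using \<sigma> K by (intro mult_right_mono) auto
        then show "norm (\<sigma> *\<^sub>R v + t *\<^sub>R w) \<le> 2 * t * K" using nb[of \<sigma> t] \<sigma> t by linarith
      qed (use \<open>\<epsilon> > 0\<close> in auto)
      finally have nA: "norm A \<le> \<epsilon> * (2 * t * K)" .
      have "norm B \<le> \<epsilon> * norm (\<sigma> *\<^sub>R v)"
        using d(2)[of "x + \<sigma> *\<^sub>R v"] mem(2)[of \<sigma> 0] \<sigma> t by (simp add: B_def)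
      also have "\<dots> \<le> \<epsilon> * (t * K)"
      proof (rule mult_left_mono)
        have "\<sigma> * K \<le> t * K" using \<sigma> K by (intro mult_right_mono) auto
        then show "norm (\<sigma> *\<^sub>R v) \<le> t * K" using nb[of \<sigma> 0] \<sigma>(1) by (simp del: norm_scaleR)
      qed (use \<open>\<epsilon> > 0\<close> in auto)
      finally have nB: "norm B \<le> \<epsilon> * (t * K)" .
      have nAB: "norm (A - B) \<le> 3 * \<epsilon> * t * K"
        using norm_triangle_ineq4[of A B] nA nB by (simp add: algebra_simps)
      have "h' \<sigma> - t * (L w \<bullet> v) = (A - B) \<bullet> v"
        using lin by (simp add: h'_def A_def B_def linear_simps inner_simps algebra_simps)
      then have "\<bar>h' \<sigma> - t * (L w \<bullet> v)\<bar> \<le> norm (A - B) * norm v"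
        using Cauchy_Schwarz_ineq2[of "A - B" v] by simp
      also have "\<dots> \<le> (3 * \<epsilon> * t * K) * K"
        using order_trans[OF norm_ge_zero nAB] nAB vw by (intro mult_mono) auto
      finally have "t * \<bar>h' \<sigma> - t * (L w \<bullet> v)\<bar> \<le> t * ((3 * \<epsilon> * t * K) * K)"
        using t by (intro mult_left_mono) auto
      moreover have "t * \<bar>h' \<sigma> - t * (L w \<bullet> v)\<bar> = \<bar>t * (h' \<sigma> - t * (L w \<bullet> v))\<bar>"
        using t by (simp add: abs_mult)
      moreover have "t * (h' \<sigma> - t * (L w \<bullet> v)) = (h t - h 0) - t\<^sup>2 * (L w \<bullet> v)"
        using \<sigma>(3) by (simp add: power2_eq_square algebra_simps)
      ultimately show ?thesis by (simp add: h_def power2_eq_square algebra_simps)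
    qed
    have "\<bar>t\<^sup>2 * (L v \<bullet> w) - t\<^sup>2 * (L w \<bullet> v)\<bar> \<le> 6 * \<epsilon> * t\<^sup>2 * K\<^sup>2"
      using key[OF K(1,2)] key[OF K(2,1)]
      by (simp add: add.commute add.left_commute)
    also have "\<bar>t\<^sup>2 * (L v \<bullet> w) - t\<^sup>2 * (L w \<bullet> v)\<bar> = t\<^sup>2 * \<bar>L v \<bullet> w - L w \<bullet> v\<bar>"
      by (simp add: abs_mult flip: right_diff_distrib)
    finally show ?thesis using t by (simp add: mult.assoc mult.left_commute)
  qed
  have "\<bar>L v \<bullet> w - L w \<bullet> v\<bar> \<le> 0"
  proof (rule field_le_epsilon)
    fix e :: real assume e: "e > 0"
    define \<epsilon> where "\<epsilon> = e / (6 * (K\<^sup>2 + 1))"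
    have K1: "K\<^sup>2 + 1 > 0" by (simp add: add_nonneg_pos)
    then have \<epsilon>: "\<epsilon> > 0" using e by (simp add: \<epsilon>_def)
    have "\<bar>L v \<bullet> w - L w \<bullet> v\<bar> \<le> 6 * \<epsilon> * K\<^sup>2" using \<epsilon> by (rule main)
    also have "\<dots> \<le> 6 * \<epsilon> * (K\<^sup>2 + 1)" using \<epsilon> by (intro mult_left_mono) auto
    also have "\<dots> = e" using K1 by (simp add: \<epsilon>_def del: distrib_left_numeral)
    finally show "\<bar>L v \<bullet> w - L w \<bullet> v\<bar> \<le> 0 + e" by simp
  qed
  then show ?thesis by simp
qed

section \<open>The equation in terms of trace and determinant\<close>

lemma proots_quadratic_Vieta:
  fixes a b x y :: "'a :: idom"
  assumes "proots [:b, - a, 1:] = {#x, y#}"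
  shows "x + y = a" "x * y = b"
proof -
  have "x \<in># proots [:b, - a, 1:]" using assms by simp
  then have root: "b - a * x + x * x = 0" by (simp add: algebra_simps)
  then have "[:b, - a, 1:] = [:- x, 1:] * [:- (a - x), 1:]"
    by (simp add: algebra_simps)
  then have "proots [:b, - a, 1:] = proots [:- x, 1:] + proots [:- (a - x), 1:]"
    by (simp only: proots_mult) (subst proots_mult, auto)
  also have "\<dots> = {#x, a - x#}" by (simp only: proots_linear_factor) simp
  finally have "y = a - x" using assms by simp
  then show "x + y = a" "x * y = b" using root by (auto simp: algebra_simps)
qed

text \<open>The phase equation becomes \<open>cos \<Theta> tr A + sin \<Theta> (det A - 1) = 0\<close>. This loses the branch of
the phase (it cannot distinguish \<open>\<Theta>\<close> from \<open>\<Theta> \<plusminus> \<pi>\<close>), which the inequality retains.\<close>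
lemma special_lagrangian_trace_det:
  fixes A :: "real^2^2"
  assumes eig: "eigenvalues A = {#l1, l2#}" and phase: "arctan l1 + arctan l2 = \<Theta>"
  shows "cos \<Theta> * (A $ 1 $ 1 + A $ 2 $ 2)
      + sin \<Theta> * (A $ 1 $ 1 * A $ 2 $ 2 - A $ 1 $ 2 * A $ 2 $ 1 - 1) = 0"
    and "sin \<Theta> * (A $ 1 $ 1 + A $ 2 $ 2) + 2 * cos \<Theta> > 0"
proof -
  have "proots [:det A, - trace A, 1:] = {#l1, l2#}"
    using eig by (simp add: eigenvalues_def charpoly_2)
  from proots_quadratic_Vieta[OF this]
  have tr: "A $ 1 $ 1 + A $ 2 $ 2 = l1 + l2"
    and dt: "A $ 1 $ 1 * A $ 2 $ 2 - A $ 1 $ 2 * A $ 2 $ 1 = l1 * l2"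
    by (simp_all add: det_2 trace_def sum_2)
  define \<alpha> \<beta> where "\<alpha> = arctan l1" and "\<beta> = arctan l2"
  have pos: "cos \<alpha> > 0" "cos \<beta> > 0"
    by (simp_all add: \<alpha>_def \<beta>_def cos_arctan add_pos_nonneg)
  have l: "sin \<alpha> = l1 * cos \<alpha>" "sin \<beta> = l2 * cos \<beta>"
    by (simp_all add: \<alpha>_def \<beta>_def sin_arctan cos_arctan)
  have \<Theta>: "\<Theta> = \<alpha> + \<beta>" using phase by (simp add: \<alpha>_def \<beta>_def)
  have cos\<Theta>: "cos \<Theta> = cos \<alpha> * cos \<beta> * (1 - l1 * l2)"
    and sin\<Theta>: "sin \<Theta> = cos \<alpha> * cos \<beta> * (l1 + l2)"
    unfolding \<Theta> cos_add sin_add l by (simp_all add: algebra_simps)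
  show "cos \<Theta> * (A $ 1 $ 1 + A $ 2 $ 2)
      + sin \<Theta> * (A $ 1 $ 1 * A $ 2 $ 2 - A $ 1 $ 2 * A $ 2 $ 1 - 1) = 0"
    unfolding tr dt cos\<Theta> sin\<Theta> by (simp add: algebra_simps)
  have "sin \<Theta> * (l1 + l2) + 2 * cos \<Theta> = cos \<alpha> * cos \<beta> * (l1\<^sup>2 + l2\<^sup>2 + 2)"
    unfolding cos\<Theta> sin\<Theta> by (simp add: algebra_simps power2_eq_square)
  moreover have "l1\<^sup>2 + l2\<^sup>2 + 2 > 0" by (simp add: add_nonneg_pos)
  ultimately show "sin \<Theta> * (A $ 1 $ 1 + A $ 2 $ 2) + 2 * cos \<Theta> > 0"
    using pos by (simp add: tr)
qed

section \<open>The normalised problem on the disc of radius two\<close>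

text \<open>A solution \<open>U\<close> on the disc of radius \<open>2\<close> in the complex plane, with gradient \<open>q\<close>. A symmetric
real-linear map of the plane has the form \<open>e \<mapsto> t e + m cnj e\<close> with \<open>t\<close> real and \<open>m\<close> complex;
the Hessian is written in this way, so that its trace is \<open>2 t\<close> and its determinant is
\<open>t\<^sup>2 - \<bar>m\<bar>\<^sup>2\<close>. The numbers \<open>S\<close> and \<open>C\<close> are the sine and the cosine of the phase,
and \<open>S \<ge> 0\<close> can be assumed because \<open>- U\<close> solves the equation with the opposite phase.
The bound \<open>M\<close> on the oscillation is taken positive so that it can be divided by.\<close>
locale special_lagrangian_disc =
  fixes U :: "complex \<Rightarrow> real" and q :: "complex \<Rightarrow> complex"
    and t :: "complex \<Rightarrow> real" and m :: "complex \<Rightarrow> complex" and S C M :: real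
  assumes dU: "cmod x < 2 \<Longrightarrow> (U has_derivative (\<lambda>e. q x \<bullet> e)) (at x)"
    and dq: "cmod x < 2 \<Longrightarrow> (q has_derivative (\<lambda>e. of_real (t x) * e + m x * cnj e)) (at x)"
    and S_nonneg: "S \<ge> 0" and SC: "S\<^sup>2 + C\<^sup>2 = 1"
    and eqn: "cmod x < 2 \<Longrightarrow> 2 * C * t x + S * ((t x)\<^sup>2 - (cmod (m x))\<^sup>2 - 1) = 0"
    and branch: "cmod x < 2 \<Longrightarrow> S * t x + C > 0"
    and osc_le: "cmod x < 2 \<Longrightarrow> cmod y < 2 \<Longrightarrow> U x - U y \<le> M"
    and M_pos: "M > 0"
begin

text \<open>Multiplied by \<open>S\<close>, the equation says that \<open>S D\<^sup>2U + C I\<close> has determinant \<open>1\<close>; by the branch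
condition this matrix has positive trace, so it is positive definite.\<close>
lemma monge_ampere:
  assumes "cmod x < 2"
  shows "(S * t x + C)\<^sup>2 = 1 + (S * cmod (m x))\<^sup>2"
proof -
  have "(S * t x + C)\<^sup>2 - (1 + (S * cmod (m x))\<^sup>2)
      = S * (2 * C * t x + S * ((t x)\<^sup>2 - (cmod (m x))\<^sup>2 - 1)) + (S\<^sup>2 + C\<^sup>2 - 1)"
    by (simp add: power2_eq_square algebra_simps)
  then show ?thesis using eqn[OF assms] SC by simp
qed

lemma hessian_lower_bound:
  assumes "cmod x < 2"
  shows "S * ((of_real (t x) * e + m x * cnj e) \<bullet> e) + C * (cmod e)\<^sup>2 \<ge> 0"
proof -
  have "(S * cmod (m x))\<^sup>2 \<le> (S * t x + C)\<^sup>2" using monge_ampere[OF assms] by simp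
  then have 1: "S * cmod (m x) \<le> S * t x + C"
    by (rule power2_le_imp_le) (use branch[OF assms] in simp)
  have "\<bar>(m x * cnj e) \<bullet> e\<bar> \<le> cmod (m x) * (cmod e)\<^sup>2"
    using Cauchy_Schwarz_ineq2[of "m x * cnj e" e] by (simp add: norm_mult power2_eq_square mult.assoc)
  then have "S * ((m x * cnj e) \<bullet> e) \<ge> S * - (cmod (m x) * (cmod e)\<^sup>2)"
    using S_nonneg by (intro mult_left_mono) auto
  moreover have "(of_real (t x) * e) \<bullet> e = t x * (cmod e)\<^sup>2"
    by (simp add: scaleR_conv_of_real[symmetric] power2_norm_eq_inner)
  moreover have "S * cmod (m x) * (cmod e)\<^sup>2 \<le> (S * t x + C) * (cmod e)\<^sup>2"
    using 1 by (rule mult_right_mono) simp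
  ultimately show ?thesis by (simp add: inner_add_left algebra_simps)
qed

lemma segment:
  assumes "cmod x < 2" "cmod y < 2" "0 \<le> s" "s \<le> 1"
  shows "cmod (x + s *\<^sub>R (y - x)) < 2"
proof -
  have "(1 - s) *\<^sub>R x + s *\<^sub>R y \<in> ball 0 2"
    using assms by (intro convexD[OF convex_ball]) auto
  then show ?thesis by (simp add: algebra_simps)
qed

lemma gradient_monotone:
  assumes xy: "cmod x < 2" "cmod y < 2"
  shows "S * ((q y - q x) \<bullet> (y - x)) + C * (cmod (y - x))\<^sup>2 \<ge> 0"
proof -
  define d where "d = y - x"
  define g where "g s = S * (q (x + s *\<^sub>R d) \<bullet> d) + C * s * (cmod d)\<^sup>2" for s :: real
  have "g 0 \<le> g 1"
  proof (rule DERIV_nonneg_imp_nondecreasing[where f = g and a = 0 and b = 1])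
    fix s :: real assume s: "0 \<le> s" "s \<le> 1"
    define z where "z = x + s *\<^sub>R d"
    have z: "cmod z < 2" using segment[OF xy s] by (simp add: z_def d_def)
    have 1: "((\<lambda>s. q (x + s *\<^sub>R d)) has_derivative
        (\<lambda>e. of_real (t z) * (e *\<^sub>R d) + m z * cnj (e *\<^sub>R d))) (at s)"
      unfolding z_def
      by (rule has_derivative_compose[OF _ dq]) (use z in \<open>auto intro!: derivative_eq_intros simp: z_def\<close>)
    have 2: "((\<lambda>s. q (x + s *\<^sub>R d) \<bullet> d) has_real_derivative (of_real (t z) * d + m z * cnj d) \<bullet> d) (at s)"
      unfolding has_field_derivative_def
      by (rule has_derivative_eq_rhs[OF has_derivative_inner_left[OF 1]])
        (auto simp: fun_eq_iff inner_complex_def algebra_simps)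
    have "(g has_real_derivative S * ((of_real (t z) * d + m z * cnj d) \<bullet> d) + C * (cmod d)\<^sup>2) (at s)"
      unfolding g_def by (auto intro!: derivative_eq_intros 2)
    then show "\<exists>y. (g has_real_derivative y) (at s) \<and> 0 \<le> y"
      using hessian_lower_bound[OF z, of d] by blast
  qed simp
  then show ?thesis by (simp add: g_def d_def inner_diff_left algebra_simps)
qed

text \<open>The function \<open>S U + C \<bar>x\<bar>\<^sup>2 / 2\<close> is convex, so it lies above its tangent planes.\<close>
lemma semiconvex:
  assumes xy: "cmod x < 2" "cmod y < 2"
  shows "S * (U x + q x \<bullet> (y - x)) \<le> S * U y + C / 2 * (cmod (y - x))\<^sup>2"
proof -
  define d where "d = y - x"
  define g where "g s = S * U (x + s *\<^sub>R d) + C / 2 * s\<^sup>2 * (cmod d)\<^sup>2 - S * s * (q x \<bullet> d)" for s :: real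
  have "g 0 \<le> g 1"
  proof (rule DERIV_nonneg_imp_nondecreasing[where f = g and a = 0 and b = 1])
    fix s :: real assume s: "0 \<le> s" "s \<le> 1"
    define z where "z = x + s *\<^sub>R d"
    have z: "cmod z < 2" using segment[OF xy s] by (simp add: z_def d_def)
    have 1: "((\<lambda>s. U (x + s *\<^sub>R d)) has_derivative (\<lambda>e. q z \<bullet> (e *\<^sub>R d))) (at s)"
      unfolding z_def
      by (rule has_derivative_compose[OF _ dU]) (use z in \<open>auto intro!: derivative_eq_intros simp: z_def\<close>)
    have 2: "((\<lambda>s. U (x + s *\<^sub>R d)) has_real_derivative q z \<bullet> d) (at s)"
      unfolding has_field_derivative_def
      by (rule has_derivative_eq_rhs[OF 1]) (auto simp: fun_eq_iff mult.commute)
    define D where "D = S * ((q z - q x) \<bullet> d) + C * s * (cmod d)\<^sup>2"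
    have "(g has_real_derivative D) (at s)"
      unfolding g_def D_def
      by (auto intro!: derivative_eq_intros 2 simp: inner_diff_left algebra_simps)
    moreover have "D \<ge> 0"
    proof (cases "s = 0")
      case False
      have "S * ((q z - q x) \<bullet> (z - x)) + C * (cmod (z - x))\<^sup>2 = s * D"
        using s by (simp add: z_def D_def power2_eq_square algebra_simps)
      with gradient_monotone[OF xy(1) z] s False show ?thesis
        by (simp add: zero_le_mult_iff)
    qed (simp add: D_def z_def)
    ultimately show "\<exists>y. (g has_real_derivative y) (at s) \<and> 0 \<le> y" by blast
  qed simp
  then show ?thesis by (simp add: g_def d_def algebra_simps)
qed

text \<open>Semiconvexity is used along the segment of length \<open>r\<close> in the direction of the gradient
(any direction where it vanishes). The free
choice of \<open>r\<close> is what the next lemma exploits.\<close>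
lemma gradient_semiconvex_bound:
  assumes x: "cmod x < 1" and r: "0 \<le> r" "r \<le> 1"
  shows "S * r * cmod (q x) \<le> S * M + C / 2 * r\<^sup>2"
proof -
  obtain v where v: "cmod v = 1" "q x \<bullet> v = cmod (q x)"
  proof (cases "q x = 0")
    case False
    then show ?thesis
      by (intro that[of "sgn (q x)"])
        (simp_all add: norm_sgn sgn_div_norm power2_norm_eq_inner[symmetric] power2_eq_square)
  qed (use that[of 1] in auto)
  define y where "y = x + r *\<^sub>R v"
  have y: "cmod (y - x) = r" using v r by (simp add: y_def)
  have y2: "cmod y < 2" using norm_triangle_ineq[of x "y - x"] y x r by simp
  have "S * U x + S * r * cmod (q x) \<le> S * U y + C / 2 * r\<^sup>2"
    using semiconvex[of x y] x y2 y v by (simp add: y_def algebra_simps)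
  moreover have "S * (U y - U x) \<le> S * M"
    using osc_le[of y x] x y2 S_nonneg by (intro mult_left_mono) auto
  ultimately show ?thesis by (simp add: algebra_simps)
qed

text \<open>If \<open>C \<le> S M\<close>, taking \<open>r = 1\<close> gives the gradient estimate at once. Otherwise
\<open>r = sqrt (S M / C)\<close>, which balances the two terms up to a constant, is less than \<open>1\<close> and gives, if
\<open>S > 0\<close>, \<open>\<bar>q\<bar>\<^sup>2 \<le> const M C / S\<close>: a weak bound on the
gradient when the phase is small, but one that makes \<open>S \<bar>q\<bar>\<^sup>2\<close> linear in \<open>M\<close>.\<close>
lemma gradient_dichotomy:
  "(\<forall>x. cmod x < 1 \<longrightarrow> cmod (q x) \<le> 3 / 2 * M) \<or>
   0 < C \<and> (\<forall>x. cmod x < 1 \<longrightarrow> S * (cmod (q x))\<^sup>2 \<le> 9 / 4 * M)"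
proof (cases "C \<le> S * M")
  case True
  have "S > 0"
  proof (rule ccontr)
    assume "\<not> S > 0"
    then have "S = 0" using S_nonneg by simp
    then show False using True branch[of 0] by simp
  qed
  have "cmod (q x) \<le> 3 / 2 * M" if x: "cmod x < 1" for x
  proof -
    have "S * cmod (q x) \<le> S * (3 / 2 * M)"
      using gradient_semiconvex_bound[OF x, of 1] True by simp
    then show ?thesis using \<open>S > 0\<close> by simp
  qed
  then show ?thesis by blast
next
  case False
  have C: "0 < C" "C \<le> 1"
  proof -
    have "0 \<le> S * M" using S_nonneg M_pos by simp
    then show "0 < C" using False by linarith
    have "C\<^sup>2 \<le> 1\<^sup>2" using SC zero_le_power2[of S] unfolding power_one by linarith
    then show "C \<le> 1" by (rule power2_le_imp_le) simp
  qed
  define r where "r = sqrt (S * M / C)"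
  have r2: "r\<^sup>2 = S * M / C" using S_nonneg M_pos C by (simp add: r_def)
  have r: "0 \<le> r" "r \<le> 1"
    using S_nonneg M_pos C False by (auto simp: r_def)
  have "S * (cmod (q x))\<^sup>2 \<le> 9 / 4 * M" if x: "cmod x < 1" for x
  proof (cases "S = 0")
    case False
    then have S: "S > 0" using S_nonneg by simp
    have "S * r * cmod (q x) \<le> S * M + C / 2 * (S * M / C)"
      using gradient_semiconvex_bound[OF x r] r2 by simp
    also have "\<dots> = S * (3 / 2 * M)" using C by simp
    finally have "r * cmod (q x) \<le> 3 / 2 * M" using S by (simp add: mult.assoc)
    then have "(r * cmod (q x))\<^sup>2 \<le> (3 / 2 * M)\<^sup>2"
      using r by (intro power_mono) auto
    then have "S * M / C * (cmod (q x))\<^sup>2 \<le> 9 / 4 * M * M"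
      unfolding power_mult_distrib r2 by (simp add: power2_eq_square)
    then have "M * (S * (cmod (q x))\<^sup>2) \<le> M * (9 / 4 * M * C)"
      using C by (simp add: field_simps)
    then have "S * (cmod (q x))\<^sup>2 \<le> 9 / 4 * M * C" using M_pos by simp
    also have "\<dots> \<le> 9 / 4 * M * 1" using C M_pos by (intro mult_left_mono) auto
    finally show ?thesis by simp
  qed (use M_pos in auto)
  then show ?thesis using C by blast
qed

end

section \<open>Small phase: bound on the phase and Lewy rotation\<close>

lemma local_max_second_derivative_nonpos:
  fixes k :: "real \<Rightarrow> real"
  assumes d: "d > 0"
    and k: "\<And>x. \<bar>x\<bar> < d \<Longrightarrow> (k has_real_derivative k' x) (at x)"
    and l: "(k' has_real_derivative l) (at 0)"
    and max: "\<And>x. \<bar>x\<bar> < d \<Longrightarrow> k x \<le> k 0"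
  shows "l \<le> 0"
proof (rule ccontr)
  assume "\<not> l \<le> 0"
  have "k' 0 = 0"
    using DERIV_local_max[OF k[of 0] d] max d by auto
  with has_real_derivative_pos_inc_right[OF l] \<open>\<not> l \<le> 0\<close>
  obtain e where e: "e > 0" "\<And>h. 0 < h \<Longrightarrow> h < e \<Longrightarrow> 0 < k' h" by auto
  define b where "b = min d e / 2"
  have b: "0 < b" "b < d" "b < e" using d e by (auto simp: b_def)
  obtain z where "0 < z" "z < b" "k b - k 0 = (b - 0) * k' z"
    using MVT2[of 0 b k k'] k b by auto
  moreover have "0 < b * k' z" if "0 < z" "z < b" for z using e b that by simp
  ultimately have "k b > k 0" by fastforce
  then show False using max[of b] b by simp
qed

text \<open>The remaining case of the dichotomy. The numbers \<open>s\<close> and \<open>c\<close> are the sine and the cosine of half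
the phase.\<close>
locale small_phase_disc = special_lagrangian_disc +
  fixes s c :: real
  assumes s_nonneg: "0 \<le> s" and c_ge: "1 / 2 \<le> c" and sc: "s\<^sup>2 + c\<^sup>2 = 1"
    and S_eq: "S = 2 * s * c" and C_eq: "C = c\<^sup>2 - s\<^sup>2"
    and q_bound: "cmod x < 1 \<Longrightarrow> S * (cmod (q x))\<^sup>2 \<le> 9 / 4 * M"
begin

lemma s_le_1: "s \<le> 1" and c_le_1: "c \<le> 1"
proof -
  have "s\<^sup>2 \<le> 1\<^sup>2" "c\<^sup>2 \<le> 1\<^sup>2" 
    using sc zero_le_power2[of s] zero_le_power2[of c] unfolding power_one by linarith+
  then show "s \<le> 1" "c \<le> 1" by (auto intro: power2_le_imp_le)
qed

text \<open>The Laplacian of \<open>U\<close> is \<open>2 t\<close>. Since \<open>S D\<^sup>2U + C I\<close> is positive definite with determinant \<open>1\<close>,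
half its trace, \<open>S t + C\<close>, is at least \<open>1\<close>.\<close>
lemma laplacian_ge:
  assumes x: "cmod x < 2" and s: "s > 0"
  shows "t x \<ge> s"
proof -
  have "1\<^sup>2 \<le> (S * t x + C)\<^sup>2" using monge_ampere[OF x] by simp
  then have "1 \<le> S * t x + C" by (rule power2_le_imp_le) (use branch[OF x] in simp)
  then have "2 * s * s \<le> 2 * s * (c * t x)"
    using sc by (simp add: S_eq C_eq power2_eq_square algebra_simps)
  then have *: "s \<le> c * t x" using s by simp
  then have "0 < c * t x" using s by linarith
  then have "0 < t x" using c_ge by (simp add: zero_less_mult_iff)
  then have "c * t x \<le> 1 * t x" using c_le_1 by (intro mult_right_mono) auto
  then show ?thesis using * by simp
qed

text \<open>If \<open>s > 0\<close>, the maximum principle and the Laplacian bound force \<open>U\<close> to oscillate: \<open>U - s \<bar>x\<bar>\<^sup>2 / 4\<close> is strictly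
subharmonic, so it attains its maximum over the closed unit disc on the circle, and not at \<open>0\<close>.
This is what makes the final estimate homogeneous in \<open>M\<close>.\<close>
lemma s_le_osc: "s \<le> 4 * M"
proof (cases "s = 0")
  case False
  then have s: "s > 0" using s_nonneg by simp
  define \<phi> where "\<phi> x = U x - s / 4 * (x \<bullet> x)" for x :: complex
  have "continuous_on (cball 0 1) U"
    by (rule has_derivative_continuous_on[OF has_derivative_at_withinI[OF dU]]) auto
  then have "continuous_on (cball 0 1) \<phi>"
    unfolding \<phi>_def by (intro continuous_intros)
  then obtain y where y: "cmod y \<le> 1" "\<And>x. cmod x \<le> 1 \<Longrightarrow> \<phi> x \<le> \<phi> y"
    using continuous_attains_sup[of "cball 0 1" \<phi>] by auto
  have second: "(of_real (t y) * v + m y * cnj v) \<bullet> v \<le> s / 2"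
    if v: "cmod v = 1" and y1: "cmod y < 1" for v
  proof -
    define k' where "k' \<sigma> = (q (y + \<sigma> *\<^sub>R v) - (s / 2) *\<^sub>R (y + \<sigma> *\<^sub>R v)) \<bullet> v" for \<sigma> :: real
    have near: "cmod (y + \<sigma> *\<^sub>R v) < 1" if "\<bar>\<sigma>\<bar> < 1 - cmod y" for \<sigma>
      using norm_triangle_ineq[of y "\<sigma> *\<^sub>R v"] v that by simp
    have "(of_real (t y) * v + m y * cnj v) \<bullet> v - s / 2 \<le> 0"
    proof (rule local_max_second_derivative_nonpos[where d = "1 - cmod y"
          and k = "\<lambda>\<sigma>. \<phi> (y + \<sigma> *\<^sub>R v)" and k' = k'])
      fix \<sigma> :: real assume \<sigma>: "\<bar>\<sigma>\<bar> < 1 - cmod y"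
      note n = near[OF \<sigma>]
      show "\<phi> (y + \<sigma> *\<^sub>R v) \<le> \<phi> (y + 0 *\<^sub>R v)" using y(2) n by simp
      have 1: "((\<lambda>\<sigma>. U (y + \<sigma> *\<^sub>R v)) has_derivative (\<lambda>e. q (y + \<sigma> *\<^sub>R v) \<bullet> (e *\<^sub>R v))) (at \<sigma>)"
        by (rule has_derivative_compose[OF _ dU]) (use n in \<open>auto intro!: derivative_eq_intros\<close>)
      show "((\<lambda>\<sigma>. \<phi> (y + \<sigma> *\<^sub>R v)) has_real_derivative k' \<sigma>) (at \<sigma>)"
        unfolding \<phi>_def has_field_derivative_def
        by (auto intro!: derivative_eq_intros 1
            simp: fun_eq_iff k'_def inner_diff_left inner_commute algebra_simps)
    next
      have 1: "((\<lambda>\<sigma>. q (y + \<sigma> *\<^sub>R v)) has_derivative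
          (\<lambda>e. of_real (t y) * (e *\<^sub>R v) + m y * cnj (e *\<^sub>R v))) (at 0)"
        by (rule has_derivative_compose[where g = q, OF _ has_derivative_eq_rhs[OF dq]])
          (use y1 in \<open>auto intro!: derivative_eq_intros\<close>)
      have vv: "v \<bullet> v = 1" using v by (simp add: norm_eq_1)
      show "(k' has_real_derivative (of_real (t y) * v + m y * cnj v) \<bullet> v - s / 2) (at 0)"
        unfolding k'_def has_field_derivative_def
        by (auto intro!: derivative_eq_intros 1
            simp: fun_eq_iff inner_diff_left inner_add_left vv algebra_simps)
    qed (use y1 in auto)
    then show ?thesis by simp
  qed
  have "\<not> cmod y < 1"
  proof
    assume y1: "cmod y < 1"
    have "2 * t y \<le> s"
      using second[of 1] second[of \<i>] y1 by (simp add: inner_complex_def)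
    then show False using laplacian_ge[of y] y1 s by simp
  qed
  then have "cmod y = 1" using y(1) by simp
  then have "\<phi> y = U y - s / 4" by (simp add: \<phi>_def norm_eq_1)
  moreover have "\<phi> 0 = U 0" by (simp add: \<phi>_def)
  ultimately show ?thesis using y(2)[of 0] osc_le[of y 0] y(1) by simp
qed (use M_pos in auto)

text \<open>The Lewy rotation turns the gradient graph \<open>(x, q x)\<close> by half the phase: \<open>\<Phi> x = c x + s q x\<close>
is the new base variable, and \<open>c q x - s x\<close> is the new fibre variable.\<close>
definition \<Phi> :: "complex \<Rightarrow> complex" where
  "\<Phi> x = of_real c * x + of_real s * q x"

lemma \<Phi>_distance:
  assumes xy: "cmod x < 2" "cmod y < 2"
  shows "cmod (y - x) \<le> 2 * cmod (\<Phi> y - \<Phi> x)"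
proof (cases "x = y")
  case False
  have "\<Phi> y - \<Phi> x = c *\<^sub>R (y - x) + s *\<^sub>R (q y - q x)"
    by (simp add: \<Phi>_def scaleR_conv_of_real algebra_simps)
  then have *: "(\<Phi> y - \<Phi> x) \<bullet> (y - x) = c * (cmod (y - x))\<^sup>2 + s * ((q y - q x) \<bullet> (y - x))"
    by (simp only: inner_add_left inner_scaleR_left power2_norm_eq_inner)
  have "(cmod (y - x))\<^sup>2 = (s\<^sup>2 + c\<^sup>2) * (cmod (y - x))\<^sup>2" using sc by simp
  also have "\<dots> \<le> 2 * c * ((\<Phi> y - \<Phi> x) \<bullet> (y - x))"
    using gradient_monotone[OF xy] unfolding * S_eq C_eq
    by (simp add: algebra_simps power2_eq_square[of s] power2_eq_square[of c])
  also have "\<dots> \<le> 2 * c * (cmod (\<Phi> y - \<Phi> x) * cmod (y - x))"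
    using c_ge by (intro mult_left_mono norm_cauchy_schwarz) auto
  also have "\<dots> \<le> 2 * 1 * (cmod (\<Phi> y - \<Phi> x) * cmod (y - x))"
    using c_le_1 by (intro mult_right_mono mult_left_mono) auto
  finally show ?thesis using False by (simp add: power2_eq_square)
qed simp

lemma d\<Phi>:
  assumes x: "cmod x < 2"
  shows "(\<Phi> has_derivative (\<lambda>e. of_real (c + s * t x) * e + of_real s * m x * cnj e)) (at x)"
  unfolding \<Phi>_def
  by (auto intro!: derivative_eq_intros dq[OF x] simp: fun_eq_iff algebra_simps)

lemma \<Phi>_coefficient_pos:
  assumes x: "cmod x < 2"
  shows "c + s * t x > 0"
proof -
  have "2 * c * (c + s * t x) = (s\<^sup>2 + c\<^sup>2) + (S * t x + C)"
    by (simp add: S_eq C_eq power2_eq_square algebra_simps)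
  then have "0 < 2 * c * (c + s * t x)" using branch[OF x] sc by simp
  then show ?thesis using c_ge by (simp add: zero_less_mult_iff)
qed

text \<open>Viewed over the new base variable, the conjugate of the fibre variable is complex
differentiable: its derivative along \<open>e\<close> is a complex multiple of the derivative of \<open>\<Phi>\<close> along
\<open>e\<close>. This is where the equation itself enters.\<close>
lemma cauchy_riemann:
  assumes x: "cmod x < 2"
  shows "of_real c * cnj (m x) / of_real (c + s * t x)
      * (of_real (c + s * t x) * e + of_real s * m x * cnj e)
    = cnj (of_real c * (of_real (t x) * e + m x * cnj e) - of_real s * e)"
proof -
  have pos: "c + s * t x \<noteq> 0" using \<Phi>_coefficient_pos[OF x] by simp
  have "s * c * (cmod (m x))\<^sup>2 = (c * t x - s) * (c + s * t x)"
    using eqn[OF x] by (simp add: S_eq C_eq power2_eq_square algebra_simps)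
  moreover have norm_m: "cnj (m x) * m x = of_real ((cmod (m x))\<^sup>2)"
    using complex_norm_square[of "m x"] by (simp add: mult.commute)
  ultimately have "of_real s * of_real c * (cnj (m x) * m x) = of_real (c * t x - s) * (of_real (c + s * t x) :: complex)"
    using norm_m by (metis of_real_mult)
  then have "of_real c * cnj (m x) * (of_real s * m x * cnj e)
      = of_real (c * t x - s) * cnj e * (of_real (c + s * t x) :: complex)"
    by (simp add: mult_ac)
  then have "of_real c * cnj (m x) / of_real (c + s * t x) * (of_real s * m x * cnj e)
     = of_real (c * t x - s) * cnj e"
    using pos by (simp add: divide_eq_eq del: of_real_add of_real_mult)
  moreover have "of_real c * cnj (m x) / of_real (c + s * t x) * (of_real (c + s * t x) * e) = of_real c * cnj (m x) * e"
    using pos by (simp del: of_real_add of_real_mult)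
  ultimately show ?thesis
    by (simp only: distrib_left) (simp add: algebra_simps)
qed

text \<open>As \<open>\<Phi>\<close> shrinks distances by the factor \<open>1 / 2\<close> at most, the image of the unit disc contains the
disc of radius \<open>1 / 2\<close> about \<open>\<Phi> 0\<close>. The inverse \<open>\<Psi>\<close> is differentiable there, and its
derivative \<open>G\<close> is described as a right inverse of the derivative of \<open>\<Phi>\<close>.\<close>
lemma \<Phi>_inverse:
  obtains \<Psi> where
    "\<And>z. z \<in> ball (\<Phi> 0) (1 / 2) \<Longrightarrow> \<Phi> (\<Psi> z) = z"
    "\<And>z. z \<in> ball (\<Phi> 0) (1 / 2) \<Longrightarrow> cmod (\<Psi> z) < 1"
    "\<Psi> (\<Phi> 0) = 0"
    "\<And>z. z \<in> ball (\<Phi> 0) (1 / 2) \<Longrightarrow> \<exists>G. (\<Psi> has_derivative G) (at z) \<and>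
        (\<forall>e. of_real (c + s * t (\<Psi> z)) * G e + of_real s * m (\<Psi> z) * cnj (G e) = e)"
proof -
  let ?B = "ball (\<Phi> 0) (1 / 2)"
  have cont: "continuous_on (ball 0 2) \<Phi>"
    by (rule has_derivative_continuous_on[OF has_derivative_at_withinI[OF d\<Phi>]]) auto
  have inj: "inj_on \<Phi> (ball 0 2)"
  proof (rule inj_onI)
    fix x y assume "x \<in> ball 0 2" "y \<in> ball 0 2" "\<Phi> x = \<Phi> y"
    then show "x = y" using \<Phi>_distance[of x y] by simp
  qed
  have sub: "?B \<subseteq> \<Phi> ` ball 0 1"
  proof (rule ball_subset_open_map_image)
    show "continuous_on (closure (ball 0 1)) \<Phi>"
      by (rule continuous_on_subset[OF cont]) auto
    have "continuous_on (ball 0 1) \<Phi>" "inj_on \<Phi> (ball 0 1)"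
      by (auto intro: continuous_on_subset[OF cont] inj_on_subset[OF inj])
    then show "open (\<Phi> ` interior (ball 0 1))"
      by (simp add: invariance_of_domain)
    show "1 / 2 \<le> cmod (\<Phi> z - \<Phi> 0)" if "z \<in> frontier (ball 0 1)" for z
      using \<Phi>_distance[of 0 z] that by simp
  qed auto
  define \<Psi> where "\<Psi> = inv_into (ball 0 1) \<Phi>"
  have \<Psi>: "\<Phi> (\<Psi> z) = z" "cmod (\<Psi> z) < 1" if "z \<in> ?B" for z
  proof -
    have z: "z \<in> \<Phi> ` ball 0 1" using sub that by blast
    show "\<Phi> (\<Psi> z) = z" unfolding \<Psi>_def by (rule f_inv_into_f[OF z])
    show "cmod (\<Psi> z) < 1" using inv_into_into[OF z] by (simp add: \<Psi>_def)
  qed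
  have "inj_on \<Phi> (ball 0 1)" by (rule inj_on_subset[OF inj]) auto
  then have \<Psi>0: "\<Psi> (\<Phi> 0) = 0" unfolding \<Psi>_def by (intro inv_into_f_f) auto
  have lip: "cmod (\<Psi> z - \<Psi> w) \<le> 2 * cmod (z - w)" if "z \<in> ?B" "w \<in> ?B" for z w
    using \<Phi>_distance[of "\<Psi> w" "\<Psi> z"] \<Psi>[OF that(1)] \<Psi>[OF that(2)] by simp
  have "continuous_on ?B \<Psi>"
  proof (rule continuous_onI)
    fix x e :: real and w assume "w \<in> ?B" "0 < e"
    then show "\<exists>d>0. \<forall>z\<in>?B. dist z w < d \<longrightarrow> dist (\<Psi> z) (\<Psi> w) \<le> e"
      using lip by (intro exI[of _ "e / 2"]) (force simp: dist_norm)
  qed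
  then have cont\<Psi>: "continuous (at z) \<Psi>" if "z \<in> ?B" for z
    using that continuous_on_eq_continuous_at by blast
  have "\<exists>G. (\<Psi> has_derivative G) (at z) \<and>
      (\<forall>e. of_real (c + s * t (\<Psi> z)) * G e + of_real s * m (\<Psi> z) * cnj (G e) = e)"
    if z: "z \<in> ?B" for z
  proof -
    define L where "L e = of_real (c + s * t (\<Psi> z)) * e + of_real s * m (\<Psi> z) * cnj e" for e
    have dL: "(\<Phi> has_derivative L) (at (\<Psi> z))"
      unfolding L_def using d\<Phi> \<Psi>(2)[OF z] by simp
    then have lin: "linear L" using has_derivative_linear by blast
    have "L e = 0 \<Longrightarrow> e = 0" for e
    proof -
      assume "L e = 0"
      have "(L e) \<bullet> e * (2 * c) \<ge> (cmod e)\<^sup>2"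
      proof -
        have *: "L e = c *\<^sub>R e + s *\<^sub>R (of_real (t (\<Psi> z)) * e + m (\<Psi> z) * cnj e)"
          by (simp add: L_def scaleR_conv_of_real algebra_simps)
        have "(cmod e)\<^sup>2 = (s\<^sup>2 + c\<^sup>2) * (cmod e)\<^sup>2" using sc by simp
        also have "\<dots> \<le> 2 * c * (c * (cmod e)\<^sup>2 + s * ((of_real (t (\<Psi> z)) * e + m (\<Psi> z) * cnj e) \<bullet> e))"
          using hessian_lower_bound[of "\<Psi> z" e] \<Psi>(2)[OF z] unfolding S_eq C_eq
          by (simp add: algebra_simps power2_eq_square[of s] power2_eq_square[of c])
        also have "\<dots> = (L e) \<bullet> e * (2 * c)"
          unfolding * by (simp only: inner_add_left inner_scaleR_left power2_norm_eq_inner mult_ac)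
        finally show ?thesis .
      qed
      then show "e = 0" using \<open>L e = 0\<close> by simp
    qed
    then have "inj L" using linear_injective_0[OF lin] by blast
    then obtain G where G: "linear G" "G \<circ> L = id" "L \<circ> G = id"
      using linear_injective_isomorphism[OF lin] by (metis comp_apply eq_id_iff ext)
    have "(\<Psi> has_derivative G) (at z)"
      by (rule has_derivative_inverse_basic[OF dL _ G(2) cont\<Psi>[OF z] open_ball z])
        (use G(1) \<Psi>(1) in \<open>auto simp: linear_conv_bounded_linear\<close>)
    moreover have "L (G e) = e" for e using G(3) by (simp add: fun_eq_iff)
    ultimately show ?thesis unfolding L_def by blast
  qed
  then show ?thesis using that[OF \<Psi> \<Psi>0] by blast
qed

text \<open>The function \<open>W\<close> is a potential of the fibre variable with respect to the base variable,
that is, \<open>dW = (c q - s x) \<bullet> d\<Phi>\<close>. As a function of \<open>\<Phi> x\<close> it is harmonic.\<close>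
definition W :: "complex \<Rightarrow> real" where
  "W x = U x + c * s / 2 * (q x \<bullet> q x - x \<bullet> x) - s\<^sup>2 * (x \<bullet> q x)"

lemma dW:
  assumes x: "cmod x < 2"
  shows "(W has_derivative (\<lambda>e. (c *\<^sub>R q x - s *\<^sub>R x) \<bullet>
      (of_real (c + s * t x) * e + of_real s * m x * cnj e))) (at x)"
proof -
  define D where "D e = of_real (t x) * e + m x * cnj e" for e
  have q: "(q has_derivative D) (at x)" unfolding D_def by (rule dq[OF x])
  have "(W has_derivative (\<lambda>e. q x \<bullet> e + c * s / 2 * (q x \<bullet> D e + D e \<bullet> q x - (x \<bullet> e + e \<bullet> x))
     - s\<^sup>2 * (x \<bullet> D e + e \<bullet> q x))) (at x)"
    unfolding W_def by (auto intro!: derivative_eq_intros dU[OF x] q)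
  moreover have "q x \<bullet> e + c * s / 2 * (q x \<bullet> D e + D e \<bullet> q x - (x \<bullet> e + e \<bullet> x))
     - s\<^sup>2 * (x \<bullet> D e + e \<bullet> q x) = (c *\<^sub>R q x - s *\<^sub>R x) \<bullet> (c *\<^sub>R e + s *\<^sub>R D e)" for e
  proof -
    have "q x \<bullet> e = (s\<^sup>2 + c\<^sup>2) * (q x \<bullet> e)" using sc by simp
    then show ?thesis
      by (simp add: inner_simps inner_commute[of e] inner_commute[of "D e"] algebra_simps power2_eq_square)
  qed
  moreover have "c *\<^sub>R e + s *\<^sub>R D e = of_real (c + s * t x) * e + of_real s * m x * cnj e" for e
    by (simp add: D_def scaleR_conv_of_real algebra_simps)
  ultimately show ?thesis by simp
qed

text \<open>The terms of \<open>W - U\<close> are linear in \<open>M\<close>: the term \<open>s \<bar>q\<bar>\<^sup>2\<close> by the case assumption, the term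
\<open>s \<bar>x\<bar>\<^sup>2\<close> by the bound on \<open>s\<close>, and the mixed term by both of them.\<close>
lemma W_bounds:
  assumes x: "cmod x < 1"
  shows "\<bar>W x - U x\<bar> \<le> 5 * M"
proof -
  have qq: "s * (cmod (q x))\<^sup>2 \<le> 9 / 4 * M"
  proof -
    have "s * 1 \<le> s * (2 * c)" using s_nonneg c_ge by (intro mult_left_mono) auto
    then have "s \<le> S" by (simp add: S_eq)
    then have "s * (cmod (q x))\<^sup>2 \<le> S * (cmod (q x))\<^sup>2" by (intro mult_right_mono) auto
    then show ?thesis using q_bound[OF x] by linarith
  qed
  have xx: "(cmod x)\<^sup>2 \<le> 1" using x by (simp add: power_le_one)
  have cs: "0 \<le> c * (s / 2)" "c * (s / 2) \<le> s / 2"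
    using s_nonneg c_ge c_le_1 by (auto intro: mult_left_le_one_le)
  have sM: "s \<le> 4 * M" by (rule s_le_osc)
  have 1: "c * (s / 2) * (cmod (q x))\<^sup>2 \<le> 9 / 8 * M"
  proof -
    have "c * (s / 2) * (cmod (q x))\<^sup>2 \<le> (s / 2) * (cmod (q x))\<^sup>2"
      using cs by (intro mult_right_mono) auto
    then show ?thesis using qq by simp
  qed
  have 2: "c * (s / 2) * (cmod x)\<^sup>2 \<le> 2 * M"
  proof -
    have "c * (s / 2) * (cmod x)\<^sup>2 \<le> (s / 2) * 1"
      using cs xx s_nonneg by (intro mult_mono) auto
    then show ?thesis using sM by simp
  qed
  have 3: "s * cmod (q x) \<le> 3 * M"
  proof (rule power2_le_imp_le)
    have "(s * cmod (q x))\<^sup>2 = s * (s * (cmod (q x))\<^sup>2)" by (simp add: power2_eq_square mult_ac)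
    also have "\<dots> \<le> (4 * M) * (9 / 4 * M)"
      by (rule mult_mono[OF sM qq]) (use s_nonneg M_pos in auto)
    finally show "(s * cmod (q x))\<^sup>2 \<le> (3 * M)\<^sup>2" by (simp add: power2_eq_square)
  qed (use M_pos in simp)
  have 4: "\<bar>s\<^sup>2 * (x \<bullet> q x)\<bar> \<le> 3 * M"
  proof -
    have "\<bar>s\<^sup>2 * (x \<bullet> q x)\<bar> \<le> s\<^sup>2 * (cmod x * cmod (q x))"
      using Cauchy_Schwarz_ineq2[of x "q x"] by (simp add: abs_mult mult_left_mono)
    also have "\<dots> = (s * cmod x) * (s * cmod (q x))" by (simp add: power2_eq_square)
    also have "\<dots> \<le> 1 * (s * cmod (q x))"
      using x s_nonneg s_le_1 by (intro mult_right_mono mult_le_one) auto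
    finally show ?thesis using 3 by simp
  qed
  have "W x - U x = c * (s / 2) * (cmod (q x))\<^sup>2 - c * (s / 2) * (cmod x)\<^sup>2 - s\<^sup>2 * (x \<bullet> q x)"
    by (simp add: W_def power2_norm_eq_inner algebra_simps)
  moreover have "0 \<le> c * (s / 2) * (cmod (q x))\<^sup>2" "0 \<le> c * (s / 2) * (cmod x)\<^sup>2"
    using cs by (auto intro: mult_nonneg_nonneg)
  ultimately show ?thesis using 1 2 4 M_pos by linarith
qed

end

section \<open>The estimate at the centre\<close>

text \<open>The interior gradient estimate for the harmonic function \<open>Re H\<close>: Cauchy's inequality is applied to
\<open>exp ((H - b) / K)\<close>, whose modulus lies between \<open>1\<close> and \<open>exp 1\<close>.\<close>
lemma harmonic_gradient_estimate:
  fixes H :: "complex \<Rightarrow> complex"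
  assumes r: "r > 0" and K: "K > 0"
    and H: "\<And>z. z \<in> ball a r \<Longrightarrow> (H has_field_derivative F z) (at z)"
    and Re: "\<And>z. z \<in> ball a r \<Longrightarrow> b \<le> Re (H z)" "\<And>z. z \<in> ball a r \<Longrightarrow> Re (H z) \<le> b + K"
  shows "cmod (F a) \<le> 6 * K / r"
proof -
  define E where "E z = exp ((H z - of_real b) / of_real K)" for z
  have dE: "(E has_field_derivative E z * (F z / of_real K)) (at z)" if "z \<in> ball a r" for z
  proof -
    have "((\<lambda>z. (H z - of_real b) / of_real K) has_field_derivative F z / of_real K) (at z)"
      using DERIV_cdivide[OF DERIV_diff[OF H[OF that] DERIV_const]] by simp
    then show ?thesis unfolding E_def by (rule DERIV_fun_exp)
  qed
  have nE: "cmod (E z) = exp ((Re (H z) - b) / K)" for z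
    by (simp add: E_def norm_exp_eq_Re)
  have "cmod ((deriv ^^ 1) E a) \<le> fact 1 * exp 1 / (r / 2) ^ 1"
  proof (rule Cauchy_inequality)
    have "E holomorphic_on ball a r"
      unfolding holomorphic_on_open[OF open_ball] using dE by blast
    then show "E holomorphic_on ball a (r / 2)" "continuous_on (cball a (r / 2)) E"
      using r by (auto intro!: holomorphic_on_imp_continuous_on elim!: holomorphic_on_subset)
    show "cmod (E x) \<le> exp 1" if "cmod (a - x) = r / 2" for x
      using Re(2)[of x] that r K by (simp add: nE dist_norm divide_le_eq)
  qed (use r in simp)
  moreover have "deriv E a = E a * (F a / of_real K)"
    by (rule DERIV_imp_deriv[OF dE]) (use r in simp)
  ultimately have "cmod (E a) * (cmod (F a) / K) \<le> 2 * exp 1 / r"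
    using K by (simp add: norm_mult norm_divide mult.commute)
  moreover have "1 * (cmod (F a) / K) \<le> cmod (E a) * (cmod (F a) / K)"
    using Re(1)[of a] r K by (intro mult_right_mono) (auto simp: nE)
  ultimately have "cmod (F a) / K \<le> 2 * exp 1 / r" by simp
  also have "\<dots> \<le> 2 * 3 / r" using exp_le r by (intro divide_right_mono mult_left_mono) auto
  finally show ?thesis using K by (simp add: divide_le_eq mult.commute)
qed

context small_phase_disc
begin

lemma gradient_at_centre: "cmod (q 0) \<le> 288 * M"
proof -
  obtain \<Psi> where \<Psi>: "\<And>z. z \<in> ball (\<Phi> 0) (1 / 2) \<Longrightarrow> \<Phi> (\<Psi> z) = z"
      "\<And>z. z \<in> ball (\<Phi> 0) (1 / 2) \<Longrightarrow> cmod (\<Psi> z) < 1"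
      "\<Psi> (\<Phi> 0) = 0"
    and d\<Psi>: "\<And>z. z \<in> ball (\<Phi> 0) (1 / 2) \<Longrightarrow> \<exists>G. (\<Psi> has_derivative G) (at z) \<and>
        (\<forall>e. of_real (c + s * t (\<Psi> z)) * G e + of_real s * m (\<Psi> z) * cnj (G e) = e)"
    by (rule \<Phi>_inverse) (rule that)
  define B where "B = ball (\<Phi> 0) (1 / 2)"
  \<comment> \<open>the conjugate of the rotated gradient, as a function of the rotated variable\<close>
  define F where "F z = cnj (of_real c * q (\<Psi> z) - of_real s * \<Psi> z)" for z
  have dF: "F field_differentiable at z" if "z \<in> B" for z
  proof -
    have z: "z \<in> ball (\<Phi> 0) (1 / 2)" using that by (simp add: B_def)
    note x = \<Psi>(2)[OF z]
    then have x2: "cmod (\<Psi> z) < 2" by simp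
    obtain G where G: "(\<Psi> has_derivative G) (at z)"
      "\<And>e. of_real (c + s * t (\<Psi> z)) * G e + of_real s * m (\<Psi> z) * cnj (G e) = e"
      using d\<Psi>[OF z] by blast
    have q\<Psi>: "((\<lambda>z. q (\<Psi> z)) has_derivative
        (\<lambda>e. of_real (t (\<Psi> z)) * G e + m (\<Psi> z) * cnj (G e))) (at z)"
      by (rule has_derivative_compose[OF G(1) dq[OF x2]])
    have "(F has_derivative (\<lambda>e. cnj (of_real c * (of_real (t (\<Psi> z)) * G e + m (\<Psi> z) * cnj (G e))
        - of_real s * G e))) (at z)"
      unfolding F_def by (auto intro!: derivative_eq_intros q\<Psi> G(1))
    then have "(F has_derivative (\<lambda>e. of_real c * cnj (m (\<Psi> z)) / of_real (c + s * t (\<Psi> z)) * e)) (at z)"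
      by (simp only: cauchy_riemann[OF x2, symmetric] G(2))
    then have "(F has_field_derivative of_real c * cnj (m (\<Psi> z)) / of_real (c + s * t (\<Psi> z))) (at z)"
      unfolding has_field_derivative_def .
    then show ?thesis by (auto simp: field_differentiable_def)
  qed
  have "continuous_on B F"
    using dF[THEN field_differentiable_imp_continuous_at]
    by (intro continuous_at_imp_continuous_on ballI)
  then obtain H where H: "\<And>z. z \<in> B \<Longrightarrow> (H has_field_derivative F z) (at z within B)"
    using holomorphic_convex_primitive[of B "{}" F] dF by (auto simp: B_def)
  have dH: "(H has_field_derivative F z) (at z)" if "z \<in> B" for z
    using H[OF that] that by (simp add: B_def at_within_open_NO_MATCH)
  \<comment> \<open>the harmonic potential and the real part of the primitive have the same gradient\<close>
  have "\<exists>k. \<forall>z\<in>B. W (\<Psi> z) - Re (H z) = k"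
  proof (rule has_derivative_zero_constant)
    fix z assume zB: "z \<in> B"
    then have z: "z \<in> ball (\<Phi> 0) (1 / 2)" by (simp add: B_def)
    have x2: "cmod (\<Psi> z) < 2" using \<Psi>(2)[OF z] by simp
    obtain G where G: "(\<Psi> has_derivative G) (at z)"
      "\<And>e. of_real (c + s * t (\<Psi> z)) * G e + of_real s * m (\<Psi> z) * cnj (G e) = e"
      using d\<Psi>[OF z] by blast
    have 1: "((\<lambda>z. W (\<Psi> z)) has_derivative (\<lambda>e. (c *\<^sub>R q (\<Psi> z) - s *\<^sub>R \<Psi> z) \<bullet> e)) (at z)"
      using has_derivative_compose[OF G(1) dW[OF x2]] by (simp only: G(2))
    have 2: "((\<lambda>z. Re (H z)) has_derivative (\<lambda>e. Re (F z * e))) (at z)"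
      using dH[OF zB] unfolding has_field_derivative_def by (rule has_derivative_Re)
    have "((\<lambda>z. W (\<Psi> z) - Re (H z)) has_derivative (\<lambda>e. 0)) (at z)"
      by (rule has_derivative_eq_rhs[OF has_derivative_diff[OF 1 2]])
        (simp add: fun_eq_iff F_def inner_complex_def algebra_simps)
    then show "((\<lambda>z. W (\<Psi> z) - Re (H z)) has_derivative (\<lambda>e. 0)) (at z within B)"
      by (rule has_derivative_at_withinI)
  qed (simp add: B_def)
  then obtain k where "\<forall>z\<in>B. W (\<Psi> z) - Re (H z) = k" ..
  then have k: "Re (H z) = W (\<Psi> z) - k" if "z \<in> B" for z using that by (simp add: algebra_simps)
  have bounds: "\<bar>Re (H z) - (U 0 - k)\<bar> \<le> 6 * M" if "z \<in> B" for z
  proof -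
    have x: "cmod (\<Psi> z) < 1" using that \<Psi>(2) by (simp add: B_def)
    then show ?thesis
      using W_bounds[OF x] k[OF that] osc_le[of "\<Psi> z" 0] osc_le[of 0 "\<Psi> z"] by simp
  qed
  have "cmod (F (\<Phi> 0)) \<le> 6 * (12 * M) / (1 / 2)"
  proof (rule harmonic_gradient_estimate[where H = H and F = F and b = "U 0 - k - 6 * M"])
    show "(H has_field_derivative F z) (at z)" if "z \<in> ball (\<Phi> 0) (1 / 2)" for z
      using dH that by (simp add: B_def)
    show "U 0 - k - 6 * M \<le> Re (H z)" "Re (H z) \<le> U 0 - k - 6 * M + 12 * M"
      if "z \<in> ball (\<Phi> 0) (1 / 2)" for z
      using bounds[of z] that by (auto simp: B_def abs_le_iff)
  qed (use M_pos in auto)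
  moreover have "cmod (F (\<Phi> 0)) = c * cmod (q 0)"
    using c_ge by (simp add: F_def \<Psi>(3) norm_mult)
  moreover have "1 / 2 * cmod (q 0) \<le> c * cmod (q 0)"
    using c_ge by (intro mult_right_mono) auto
  ultimately show ?thesis by simp
qed

end

context special_lagrangian_disc
begin

lemma gradient_estimate: "cmod (q 0) \<le> 288 * M"
proof -
  consider "\<And>x. cmod x < 1 \<Longrightarrow> cmod (q x) \<le> 3 / 2 * M"
    | "0 < C" "\<And>x. cmod x < 1 \<Longrightarrow> S * (cmod (q x))\<^sup>2 \<le> 9 / 4 * M"
    using gradient_dichotomy by blast
  then show ?thesis
  proof cases
    case 1
    have "cmod (q 0) \<le> 3 / 2 * M" by (rule 1) simp
    then show ?thesis using M_pos by linarith
  next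
    case 2
    have "C\<^sup>2 \<le> 1\<^sup>2" using SC zero_le_power2[of S] unfolding power_one by linarith
    then have C1: "C \<le> 1" by (rule power2_le_imp_le) simp
    \<comment> \<open>half-angle formulas\<close>
    define s c where "s = sqrt ((1 - C) / 2)" and "c = sqrt ((1 + C) / 2)"
    have s2: "s\<^sup>2 = (1 - C) / 2" and c2: "c\<^sup>2 = (1 + C) / 2"
      using 2 C1 by (auto simp: s_def c_def)
    interpret small_phase_disc U q t m S C M s c
    proof
      show s0: "0 \<le> s" using C1 by (simp add: s_def)
      have "(1 / 2)\<^sup>2 \<le> c\<^sup>2" unfolding c2 using 2(1) by (simp add: power2_eq_square)
      then show c: "1 / 2 \<le> c" by (rule power2_le_imp_le) (use 2 in \<open>simp add: c_def\<close>)
      show "s\<^sup>2 + c\<^sup>2 = 1" "C = c\<^sup>2 - s\<^sup>2" by (simp_all add: s2 c2 field_simps)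
      have "S\<^sup>2 = (2 * s * c)\<^sup>2"
        using SC by (simp add: power_mult_distrib s2 c2 power2_eq_square[of C] field_simps)
      then show "S = 2 * s * c"
        by (rule power2_eq_imp_eq) (use S_nonneg s0 c in auto)
    qed (use 2 in auto)
    show ?thesis using gradient_at_centre M_pos by simp
  qed
qed

end

section \<open>Reduction to the normalised problem\<close>

lemma has_derivative_partials_2:
  fixes f :: "real^2 \<Rightarrow> real"
  assumes "f differentiable at x"
  shows "(f has_derivative (\<lambda>e. partial_derivative 1 f x * e $ 1 + partial_derivative 2 f x * e $ 2)) (at x)"
proof -
  let ?L = "frechet_derivative f (at x)"
  have d: "(f has_derivative ?L) (at x)" using assms by (simp add: frechet_derivative_works)
  then have lin: "linear ?L" by (rule has_derivative_linear)
  have "?L e = partial_derivative 1 f x * e $ 1 + partial_derivative 2 f x * e $ 2" for e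
  proof -
    have "e = e $ 1 *\<^sub>R axis 1 1 + e $ 2 *\<^sub>R axis 2 1"
      by (simp add: vec_eq_iff forall_2 axis_def)
    then have "?L e = ?L (e $ 1 *\<^sub>R axis 1 1 + e $ 2 *\<^sub>R axis 2 1)" by simp
    also have "\<dots> = e $ 1 * ?L (axis 1 1) + e $ 2 * ?L (axis 2 1)"
      using lin by (simp add: linear_add linear_scale)
    finally show ?thesis by (simp add: partial_derivative_def mult.commute)
  qed
  then have "?L = (\<lambda>e. partial_derivative 1 f x * e $ 1 + partial_derivative 2 f x * e $ 2)"
    by blast
  with d show ?thesis by simp
qed

text \<open>The affine parametrisation of the plane by complex numbers that takes \<open>0\<close> to \<open>x0\<close> and scales
distances by \<open>R\<close>.\<close>
definition blow_up :: "real^2 \<Rightarrow> real \<Rightarrow> complex \<Rightarrow> real^2" where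
  "blow_up x0 R z = x0 + R *\<^sub>R vector [Re z, Im z]"

lemma blow_up_nth: "blow_up x0 R z $ 1 = x0 $ 1 + R * Re z" "blow_up x0 R z $ 2 = x0 $ 2 + R * Im z"
  by (simp_all add: blow_up_def)

lemma norm_vec_2: "norm (v :: real^2) = sqrt ((v $ 1)\<^sup>2 + (v $ 2)\<^sup>2)"
  by (simp add: norm_vec_def L2_set_def sum_2)

lemma blow_up_in_ball:
  assumes "R > 0" "x0 \<in> ball 0 R" "cmod z < 2"
  shows "blow_up x0 R z \<in> ball 0 (3 * R)"
proof -
  have "norm (vector [Re z, Im z] :: real^2) = cmod z"
    by (simp add: norm_vec_2 cmod_def)
  then have "norm (blow_up x0 R z) \<le> norm x0 + R * cmod z"
    using norm_triangle_ineq[of x0 "R *\<^sub>R vector [Re z, Im z]"] assms(1) by (simp add: blow_up_def)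
  also have "\<dots> < R + R * 2"
    using assms by (intro add_strict_mono mult_strict_left_mono) auto
  finally show ?thesis by simp
qed

lemma has_derivative_blow_up:
  "(blow_up x0 R has_derivative (\<lambda>e. R *\<^sub>R vector [Re e, Im e])) (at z)"
proof -
  have "linear (\<lambda>e. R *\<^sub>R vector [Re e, Im e] :: real^2)"
    by (rule linearI) (simp_all add: vec_eq_iff forall_2 algebra_simps)
  then have "((\<lambda>e. R *\<^sub>R vector [Re e, Im e] :: real^2) has_derivative (\<lambda>e. R *\<^sub>R vector [Re e, Im e])) (at z)"
    by (simp add: bounded_linear_imp_has_derivative linear_conv_bounded_linear)
  then show ?thesis
    unfolding blow_up_def[abs_def] by (rule has_derivative_eq_rhs[OF has_derivative_add[OF has_derivative_const]]) simp
qed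

text \<open>The solution is rescaled to \<open>\<sigma> u (x0 + R z) / R\<^sup>2\<close>, where the factor \<open>1 / R\<^sup>2\<close> preserves the
Hessian and the sign \<open>\<sigma>\<close> makes the sine of the phase nonnegative. The rescaled
oscillation is at most \<open>K / R\<^sup>2\<close> and the rescaled gradient is \<open>\<sigma> Du / R\<close>.\<close>
lemma gradient_bound:
  fixes u :: "real^2 \<Rightarrow> real"
  assumes R: "R > 0" and smooth: "smooth_on u (ball 0 (3 * R))"
    and sl: "special_lagrangian_on \<Theta> u (ball 0 (3 * R))"
    and K: "K > 0" "\<And>x y. x \<in> ball 0 (3 * R) \<Longrightarrow> y \<in> ball 0 (3 * R) \<Longrightarrow> u x - u y \<le> K"
    and x0: "x0 \<in> ball 0 R"
  shows "norm (grad u x0) \<le> 288 * (K / R)"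
proof -
  let ?v = "blow_up x0 R"
  let ?p = "\<lambda>i. partial_derivative i u"
  define A where "A z = hessian u (?v z)" for z
  define \<sigma> :: real where "\<sigma> = (if sin \<Theta> \<ge> 0 then 1 else - 1)"
  have \<sigma>: "\<sigma> * \<sigma> = 1" "\<bar>\<sigma>\<bar> = 1" "\<sigma> * sin \<Theta> \<ge> 0" by (auto simp: \<sigma>_def)
  have v: "?v z \<in> ball 0 (3 * R)" if "cmod z < 2" for z
    using blow_up_in_ball[OF R x0 that] .
  have C2: "C_k_on (Suc (Suc 0)) u (ball 0 (3 * R))"
    using smooth unfolding smooth_on_def by blast
  have du: "u differentiable at x" if "x \<in> ball 0 (3 * R)" for x
    using C2 that by auto
  have dp: "?p i differentiable at x" if "x \<in> ball 0 (3 * R)" for i x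
    using C2 that by auto
  define U where "U z = \<sigma> * u (?v z) / R\<^sup>2" for z
  define q where "q z = of_real \<sigma> * Complex (?p 1 (?v z) / R) (?p 2 (?v z) / R)" for z
  define t where "t z = \<sigma> * (A z $ 1 $ 1 + A z $ 2 $ 2) / 2" for z
  define m where "m z = of_real \<sigma> * Complex ((A z $ 1 $ 1 - A z $ 2 $ 2) / 2) (A z $ 1 $ 2)" for z
  have dU: "(U has_derivative (\<lambda>e. q z \<bullet> e)) (at z)" if "cmod z < 2" for z
  proof -
    have 1: "((\<lambda>z. u (?v z)) has_derivative (\<lambda>e. R * (?p 1 (?v z) * Re e + ?p 2 (?v z) * Im e))) (at z)"
      by (rule has_derivative_eq_rhs[OF has_derivative_compose[OF has_derivative_blow_up
              has_derivative_partials_2[OF du[OF v[OF that]]]]])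
        (simp add: fun_eq_iff algebra_simps)
    have "((\<lambda>z. \<sigma> / R\<^sup>2 * u (?v z)) has_derivative
        (\<lambda>e. \<sigma> / R\<^sup>2 * (R * (?p 1 (?v z) * Re e + ?p 2 (?v z) * Im e)))) (at z)"
      using 1 by (rule has_derivative_mult_right)
    moreover have "(\<lambda>z. \<sigma> / R\<^sup>2 * u (?v z)) = U" by (simp add: U_def fun_eq_iff)
    moreover have "\<sigma> / R\<^sup>2 * (R * (?p 1 (?v z) * Re e + ?p 2 (?v z) * Im e)) = q z \<bullet> e" for e
      using R by (simp add: q_def inner_complex_def power2_eq_square field_simps)
    ultimately show ?thesis by simp
  qed
  \<comment> \<open>\<open>sym\<close> below identifies the mixed entries of the Hessian; until then both are kept\<close>
  define L where "L z e = of_real \<sigma> * Complex (A z $ 1 $ 1 * Re e + A z $ 2 $ 1 * Im e)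
      (A z $ 1 $ 2 * Re e + A z $ 2 $ 2 * Im e)" for z e
  have dL: "(q has_derivative L z) (at z)" if "cmod z < 2" for z
  proof -
    have 1: "((\<lambda>z. ?p j (?v z)) has_derivative (\<lambda>e. R * (A z $ 1 $ j * Re e + A z $ 2 $ j * Im e))) (at z)" for j
      by (rule has_derivative_eq_rhs[OF has_derivative_compose[OF has_derivative_blow_up
              has_derivative_partials_2[OF dp[OF v[OF that]]]]])
        (simp add: fun_eq_iff A_def hessian_def algebra_simps)
    have 2: "((\<lambda>z. ?p j (?v z) / R) has_derivative (\<lambda>e. A z $ 1 $ j * Re e + A z $ 2 $ j * Im e)) (at z)" for j
      using has_derivative_mult_right[OF 1, of "1 / R" j] R by simp
    have 3: "((\<lambda>z. of_real (?p 1 (?v z) / R) + \<i> * of_real (?p 2 (?v z) / R)) has_derivative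
      (\<lambda>e. of_real (A z $ 1 $ 1 * Re e + A z $ 2 $ 1 * Im e) + \<i> * of_real (A z $ 1 $ 2 * Re e + A z $ 2 $ 2 * Im e))) (at z)"
      by (intro has_derivative_add has_derivative_mult_right has_derivative_of_real 2)
    then show ?thesis
      unfolding q_def[abs_def] L_def[abs_def] Complex_eq by (rule has_derivative_mult_right)
  qed
  have sym: "A z $ 1 $ 2 = A z $ 2 $ 1" if "cmod z < 2" for z
  proof -
    have "L z 1 \<bullet> \<i> = L z \<i> \<bullet> 1"
      by (rule gradient_derivative_symmetric[where S = "ball 0 2" and x = z and f = U and g = q])
        (use that dU dL in auto)
    then show ?thesis using \<sigma>(2) by (auto simp: L_def inner_complex_def)
  qed
  have phase: "cos \<Theta> * (A z $ 1 $ 1 + A z $ 2 $ 2)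
      + sin \<Theta> * (A z $ 1 $ 1 * A z $ 2 $ 2 - A z $ 1 $ 2 * A z $ 2 $ 1 - 1) = 0"
    "sin \<Theta> * (A z $ 1 $ 1 + A z $ 2 $ 2) + 2 * cos \<Theta> > 0" if "cmod z < 2" for z
    using sl v[OF that] special_lagrangian_trace_det unfolding special_lagrangian_on_def A_def by blast+
  interpret special_lagrangian_disc U q t m "\<sigma> * sin \<Theta>" "cos \<Theta>" "K / R\<^sup>2"
  proof
    fix z assume z: "cmod z < 2"
    show "(U has_derivative (\<lambda>e. q z \<bullet> e)) (at z)" by (rule dU[OF z])
    have "L z e = of_real (t z) * e + m z * cnj e" for e
      using sym[OF z] by (simp add: L_def t_def m_def complex_eq_iff field_simps)
    then show "(q has_derivative (\<lambda>e. of_real (t z) * e + m z * cnj e)) (at z)"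
      using dL[OF z] by (metis (no_types, lifting) ext)
    have "(t z)\<^sup>2 = (\<sigma> * \<sigma>) * ((A z $ 1 $ 1 + A z $ 2 $ 2) / 2)\<^sup>2"
      by (simp add: t_def power2_eq_square)
    moreover have "(cmod (m z))\<^sup>2 = ((A z $ 1 $ 1 - A z $ 2 $ 2) / 2)\<^sup>2 + (A z $ 1 $ 2)\<^sup>2"
      using \<sigma>(2) by (simp add: m_def norm_mult cmod_power2)
    ultimately have "(t z)\<^sup>2 - (cmod (m z))\<^sup>2 = A z $ 1 $ 1 * A z $ 2 $ 2 - A z $ 1 $ 2 * A z $ 2 $ 1"
      using sym[OF z] \<sigma>(1) by (simp add: power2_eq_square field_simps)
    moreover have "2 * cos \<Theta> * t z = \<sigma> * (cos \<Theta> * (A z $ 1 $ 1 + A z $ 2 $ 2))"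
      by (simp add: t_def)
    ultimately have "2 * cos \<Theta> * t z + \<sigma> * sin \<Theta> * ((t z)\<^sup>2 - (cmod (m z))\<^sup>2 - 1)
       = \<sigma> * (cos \<Theta> * (A z $ 1 $ 1 + A z $ 2 $ 2)
      + sin \<Theta> * (A z $ 1 $ 1 * A z $ 2 $ 2 - A z $ 1 $ 2 * A z $ 2 $ 1 - 1))"
      by (simp only: distrib_left mult.assoc)
    then show "2 * cos \<Theta> * t z + \<sigma> * sin \<Theta> * ((t z)\<^sup>2 - (cmod (m z))\<^sup>2 - 1) = 0"
      using phase(1)[OF z] by simp
    have "\<sigma> * sin \<Theta> * t z = (\<sigma> * \<sigma>) * (sin \<Theta> * (A z $ 1 $ 1 + A z $ 2 $ 2)) / 2"
      by (simp add: t_def)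
    then have "\<sigma> * sin \<Theta> * t z = sin \<Theta> * (A z $ 1 $ 1 + A z $ 2 $ 2) / 2"
      unfolding \<sigma>(1) by simp
    then show "\<sigma> * sin \<Theta> * t z + cos \<Theta> > 0"
      using phase(2)[OF z] by linarith
    fix w assume w: "cmod w < 2"
    have "\<sigma> * (u (?v z) - u (?v w)) \<le> K"
      using K(2)[OF v[OF z] v[OF w]] K(2)[OF v[OF w] v[OF z]] by (auto simp: \<sigma>_def)
    then have "\<sigma> * (u (?v z) - u (?v w)) / R\<^sup>2 \<le> K / R\<^sup>2" by (rule divide_right_mono) simp
    then show "U z - U w \<le> K / R\<^sup>2" by (simp add: U_def right_diff_distrib diff_divide_distrib)
  next
    show "(\<sigma> * sin \<Theta>)\<^sup>2 + (cos \<Theta>)\<^sup>2 = 1"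
      by (simp add: power_mult_distrib \<sigma>_def)
  qed (use \<sigma>(3) K(1) R in auto)
  have "?v 0 = x0" by (simp add: vec_eq_iff forall_2 blow_up_nth)
  then have "cmod (q 0) = cmod (Complex (?p 1 x0 / R) (?p 2 x0 / R))"
    using \<sigma>(2) unfolding q_def norm_mult by simp
  also have "\<dots> = sqrt ((?p 1 x0 / R)\<^sup>2 + (?p 2 x0 / R)\<^sup>2)"
    by (simp add: cmod_def)
  also have "\<dots> = norm ((1 / R) *\<^sub>R grad u x0)"
    by (simp add: norm_vec_2 grad_def)
  also have "\<dots> = norm (grad u x0) / R" using R by simp
  finally have "norm (grad u x0) / R \<le> 288 * (K / R\<^sup>2)" using gradient_estimate by simp
  then show ?thesis using R by (simp add: field_simps power2_eq_square)
qed

section \<open>The gradient estimate\<close>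

theorem theorem1p2:
  shows "\<exists>C::real. C > 0 \<and>
    (\<forall>(R::real) (\<Theta>::real) (u :: real^2 \<Rightarrow> real).
       R > 0 \<longrightarrow> smooth_on u (ball 0 (3 * R)) \<longrightarrow>
       special_lagrangian_on \<Theta> u (ball 0 (3 * R)) \<longrightarrow>
       (SUP x\<in>ball 0 R. ereal (norm (grad u x)))
         \<le> ereal C * (osc (\<lambda>x. u x / R) (ball 0 (3 * R)) + 1))"
proof (intro exI[of _ 288] conjI allI impI)
  fix R \<Theta> :: real and u :: "real^2 \<Rightarrow> real"
  assume R: "R > 0" and u: "smooth_on u (ball 0 (3 * R))"
    "special_lagrangian_on \<Theta> u (ball 0 (3 * R))"
  let ?B = "ball (0 :: real^2) (3 * R)"
  define a b where "a = (SUP x\<in>?B. ereal (u x / R))" and "b = (INF x\<in>?B. ereal (u x / R))"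
  have le: "ereal (u x / R) \<le> a" "b \<le> ereal (u x / R)" if "x \<in> ?B" for x
    using that by (auto simp: a_def b_def intro: SUP_upper INF_lower)
  have osc: "osc (\<lambda>x. u x / R) ?B = a - b" by (simp add: osc_def a_def b_def)
  show "(SUP x\<in>ball 0 R. ereal (norm (grad u x))) \<le> ereal 288 * (osc (\<lambda>x. u x / R) ?B + 1)"
  proof (cases "a = \<infinity> \<or> b = - \<infinity>")
    case True
    have "0 \<in> ?B" using R by simp
    then have "a \<noteq> - \<infinity>" "b \<noteq> \<infinity>" using le[of 0] by auto
    then have "a - b = \<infinity>" using True by (cases a; cases b) auto
    then show ?thesis by (simp add: osc)
  next
    case False
    have "0 \<in> ?B" using R by simp
    then have "a \<noteq> - \<infinity>" "b \<noteq> \<infinity>" using le[of 0] by auto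
    then obtain a' b' where ab: "a = ereal a'" "b = ereal b'" using False by (cases a; cases b) auto
    have le': "u x / R \<le> a'" "b' \<le> u x / R" if "x \<in> ?B" for x using le[OF that] by (auto simp: ab)
    define k where "k = a' - b'"
    have k: "k \<ge> 0" using le'[OF \<open>0 \<in> ?B\<close>] by (simp add: k_def)
    have "norm (grad u x) \<le> 288 * (k + 1)" if x: "x \<in> ball 0 R" for x
    proof -
      \<comment> \<open>adding \<open>1\<close> makes the bound positive even when \<open>u\<close> is constant\<close>
      have "norm (grad u x) \<le> 288 * (R * (k + 1) / R)"
      proof (rule gradient_bound[OF R u _ _ x])
        show "R * (k + 1) > 0" using R k by simp
        fix y z assume "y \<in> ?B" "z \<in> ?B"
        then have "u y / R - u z / R \<le> k + 1" using le'(1)[of y] le'(2)[of z] by (simp add: k_def)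
        then show "u y - u z \<le> R * (k + 1)"
          using R by (simp add: diff_divide_distrib[symmetric] divide_le_eq mult.commute)
      qed
      then show ?thesis using R by simp
    qed
    then have "(SUP x\<in>ball 0 R. ereal (norm (grad u x))) \<le> ereal (288 * (k + 1))"
      by (intro SUP_least) simp
    also have "\<dots> = ereal 288 * (osc (\<lambda>x. u x / R) ?B + 1)"
      by (simp add: osc ab k_def one_ereal_def)
    finally show ?thesis .
  qed
qed simp

end
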